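(* Consider the model $Y_i=f_0(x_i)+\varepsilon_i$, $i=1,\dots,n$, with $\varepsilon_i$ i.i.d. $\mathcal N(0,1)$ and $x_i=i/n$. Let $f_0:[0,1]\to\mathbb R$ be a step function with $K_0$ steps, where $K_0$ is unknown, with vector of step heights $\boldsymbol\beta^0=(\beta^0_1,\dots,\beta^0_{K_0})'$. Let $\mathcal F$ be the set of all step functions supported on equivalent blocks, equipped with the prior $\Pi$ under which (i) the number of blocks $K$ satisfies $\Pi(K=k)\propto \exp(-c_K\,k\log k)$ for $k=1,2,\dots$, where $c_K>0$ is a fixed constant; (ii) given $K$, the partition is the equivalent-blocks partition $\boldsymbol\Omega^{EB}_K$ with $K$ cells; and (iii) given $K$, the step heights $\beta_1,\dots,\beta_K$ are independent standard normal. Write $K_{f_0}= K(f_0,\boldsymbol\Omega^{EB})$ for the complexity of $f_0$ with respect to the class $\boldsymbol\Omega^{EB}$ of equivalent-blocks partitions, and assume $\|\boldsymbol\beta^0\|_\infty^2\lesssim \log n$ and $K_{f_0}\lesssim\sqrt n$. Then, for every sequence $M_n\to\infty$ as $n\to\infty$, $$\Pi\left(f\in\mathcal F:\ \|f-f_0\|_n\ \ge\ M_n\, n^{-1/2}\sqrt{K_{f_0}\log(n/K_{f_0})}\ \Big|\ \boldsymbol Y^{(n)}\right)\longrightarrow 0$$ in $P_{f_0}^n$-probability as $n\to\infty$.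
   Context: **Model and norms.** The covariates $x_i=i/n$ are fixed. $\boldsymbol Y^{(n)}=(Y_1,\dots,Y_n)'$. $P_f^n$ denotes the joint law of the $n$ independent observations when the regression function is $f$. $\|g\|_n^2=\frac1n\sum_{i=1}^n g(x_i)^2$. The notation $a\lesssim b$ means $a\le Cb$ for a constant $C$ not depending on $n$; $\propto$ means equality up to a normalizing constant. $\|\boldsymbol\beta^0\|_\infty=\max_k|\beta_k^0|$. $\Pi(\cdot\mid\boldsymbol Y^{(n)})$ is the posterior distribution obtained from the prior $\Pi$ and the Gaussian likelihood of the model. **True function.** $f_0(x)=\sum_{k=1}^{K_0}\beta_k^0\,\mathbb I_{\Omega_k^0}(x)$, where $\{\Omega_k^0\}_{k=1}^{K_0}$ is a partition of $[0,1]$ into $K_0$ non-overlapping intervals which is minimal, i.e. $f_0$ cannot be represented with a partition having fewer than $K_0$ pieces. The function $f_0$, and hence $K_0$, $\boldsymbol\beta^0$ and $K_{f_0}$, may depend on $n$. **Equivalent blocks.** Let $x_{(i)}$ be the $i$-th order statistic of $x_1,\dots,x_n$, with $x_{(0)}=0$ and $x_{(n)}=1$. If $n=Kc$ for a positive integer $c$, the partition into $K$ equivalent blocks consists of $\Omega_k=(x_{(j_k)},x_{(j_{k+1})}]$, $k=1,\dots,K$, with $j_k=(k-1)c$ (every cell contains the same number of observations). On the grid $x_i=i/n$ this is the equispaced partition $\Omega_k=\left(\frac{k-1}{K},\frac kK\right]$, $k=1,\dots,K$. For every $K\ge1$, $\boldsymbol\Omega^{EB}_K$ denotes this single equispaced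 partition with $K$ cells, and $\boldsymbol\Omega^{EB}=\bigcup_{K\ge1}\boldsymbol\Omega^{EB}_K$ is the collection of all these partitions. (Whether the point $0$ is included in the first cell is immaterial.) **Space of functions.** $\mathcal F=\bigcup_{K=1}^\infty\mathcal F_K$, where $\mathcal F_K$ is the set of functions $f_{\boldsymbol\beta}(x)=\sum_{k=1}^K\beta_k\mathbb I_{\Omega_k}(x)$ with $\boldsymbol\beta\in\mathbb R^K$ and $\{\Omega_k\}_{k=1}^K$ the partition $\boldsymbol\Omega_K^{EB}$. **Complexity.** For an interval $V\subset[0,1]$ let $m(V;\{\Omega^0_k\}_{k=1}^{K_0})$ be the number of cells $\Omega_k^0$ with $\Omega_k^0\cap V\ne\emptyset$. For a class of partitions $\boldsymbol\Omega$, the complexity $K(f_0,\boldsymbol\Omega)$ is the smallest $K$ such that there is a partition $\{\Omega_k\}_{k=1}^K$ in $\boldsymbol\Omega$ with $K$ cells for which $m(\Omega_k;\{\Omega_j^0\}_{j=1}^{K_0})=1$ for all $k=1,\dots,K$. *)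

theory Defs
  imports "HOL-Probability.Probability" "HOL-Library.Extended_Nat"
begin

text \<open>A partition with \<open>K\<close> cells is an indexed family \<open>\<Omega> 1, \<dots>, \<Omega> K\<close>; only the values of
  \<open>\<Omega>\<close> and \<open>\<beta>\<close> on \<open>{1..K}\<close> matter.\<close>

definition step_fun :: "nat \<Rightarrow> (nat \<Rightarrow> real set) \<Rightarrow> (nat \<Rightarrow> real) \<Rightarrow> real \<Rightarrow> real" where
  "step_fun K \<Omega> \<beta> = (\<lambda>x. \<Sum>k=1..K. \<beta> k * indicator (\<Omega> k) x)"

definition interval_partition :: "nat \<Rightarrow> (nat \<Rightarrow> real set) \<Rightarrow> bool" where
  "interval_partition K \<Omega> \<longleftrightarrow>
     (\<forall>k\<in>{1..K}. is_interval (\<Omega> k) \<and> \<Omega> k \<noteq> {}) \<and>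
     disjoint_family_on \<Omega> {1..K} \<and> (\<Union>k\<in>{1..K}. \<Omega> k) = {0..1}"

definition represents :: "(real \<Rightarrow> real) \<Rightarrow> nat \<Rightarrow> (nat \<Rightarrow> real set) \<Rightarrow> (nat \<Rightarrow> real) \<Rightarrow> bool" where
  "represents f K \<Omega> \<beta> \<longleftrightarrow>
     interval_partition K \<Omega> \<and> (\<forall>x\<in>{0..1}. f x = step_fun K \<Omega> \<beta> x)"

definition minimally_represents ::
    "(real \<Rightarrow> real) \<Rightarrow> nat \<Rightarrow> (nat \<Rightarrow> real set) \<Rightarrow> (nat \<Rightarrow> real) \<Rightarrow> bool" where
  "minimally_represents f K \<Omega> \<beta> \<longleftrightarrow>
     represents f K \<Omega> \<beta> \<and> (\<forall>K' \<Omega>' \<beta>'. represents f K' \<Omega>' \<beta>' \<longrightarrow> K \<le> K')"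

text \<open>The equispaced cells cover \<open>(0,1]\<close>; the point \<open>0\<close>, which is never a design point,
  belongs to no cell.\<close>

definition eb_cell :: "nat \<Rightarrow> nat \<Rightarrow> real set" where
  "eb_cell K k = {(real k - 1) / real K <.. real k / real K}"

definition eb_partitions :: "(nat \<times> (nat \<Rightarrow> real set)) set" where
  "eb_partitions = {(K, eb_cell K) | K. K \<ge> 1}"

definition eb_step_functions :: "(real \<Rightarrow> real) set" where
  "eb_step_functions = (\<Union>K\<in>{1..}. range (step_fun K (eb_cell K)))"

definition cells_met :: "real set \<Rightarrow> nat \<Rightarrow> (nat \<Rightarrow> real set) \<Rightarrow> nat" where
  "cells_met V K0 \<Omega>0 = card {j \<in> {1..K0}. \<Omega>0 j \<inter> V \<noteq> {}}"

text \<open>The value is \<open>\<infinity>\<close> if no partition of the class is fine enough.\<close>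

definition complexity ::
    "nat \<Rightarrow> (nat \<Rightarrow> real set) \<Rightarrow> (nat \<times> (nat \<Rightarrow> real set)) set \<Rightarrow> enat" where
  "complexity K0 \<Omega>0 \<P> =
     Inf {enat K | K \<Omega>. (K, \<Omega>) \<in> \<P> \<and> (\<forall>k\<in>{1..K}. cells_met (\<Omega> k) K0 \<Omega>0 = 1)}"

definition emp_norm :: "nat \<Rightarrow> (real \<Rightarrow> real) \<Rightarrow> real" where
  "emp_norm n g = sqrt (1 / real n * (\<Sum>i=1..n. (g (real i / real n))\<^sup>2))"

definition obs_law :: "nat \<Rightarrow> (real \<Rightarrow> real) \<Rightarrow> (nat \<Rightarrow> real) measure" where
  "obs_law n f =
     distr (\<Pi>\<^sub>M i\<in>{1..n}. std_normal_distribution) (\<Pi>\<^sub>M i\<in>{1..n}. borel)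
       (\<lambda>\<epsilon>. \<lambda>i\<in>{1..n}. f (real i / real n) + \<epsilon> i)"

definition likelihood :: "nat \<Rightarrow> (real \<Rightarrow> real) \<Rightarrow> (nat \<Rightarrow> real) \<Rightarrow> real" where
  "likelihood n f Y = (\<Prod>i=1..n. normal_density (f (real i / real n)) 1 (Y i))"

definition block_weight :: "real \<Rightarrow> nat \<Rightarrow> real" where
  "block_weight c k = (if k = 0 then 0 else exp (- c * real k * ln (real k)))"

definition block_count_pmf :: "real \<Rightarrow> nat pmf" where
  "block_count_pmf c = embed_pmf (\<lambda>k. block_weight c k / (\<Sum>j. block_weight c j))"

text \<open>The space of equivalent-block step functions carries the trace of the product sigma-algebra,
  generated by the evaluations \<open>f \<mapsto> f x\<close>. (The set of these functions is not itself a
  measurable subset of the full product space.)\<close>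

definition step_space :: "(real \<Rightarrow> real) measure" where
  "step_space = restrict_space (\<Pi>\<^sub>M x\<in>UNIV. borel) eb_step_functions"

definition eb_prior :: "real \<Rightarrow> (real \<Rightarrow> real) measure" where
  "eb_prior c = measure_pmf (block_count_pmf c) \<bind>
     (\<lambda>K. distr (\<Pi>\<^sub>M k\<in>{1..K}. std_normal_distribution) step_space (step_fun K (eb_cell K)))"

definition posterior :: "(real \<Rightarrow> real) measure \<Rightarrow> nat \<Rightarrow> (nat \<Rightarrow> real) \<Rightarrow> (real \<Rightarrow> real) measure" where
  "posterior prior n Y =
     density prior (\<lambda>f. ennreal (likelihood n f Y) / (\<integral>\<^sup>+ g. ennreal (likelihood n g Y) \<partial>prior))"

definition tendsto_0_in_prob :: "(nat \<Rightarrow> 'a measure) \<Rightarrow> (nat \<Rightarrow> 'a \<Rightarrow> real) \<Rightarrow> bool" where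
  "tendsto_0_in_prob P X \<longleftrightarrow>
     (\<forall>\<delta>>0. (\<lambda>n. measure (P n) {y \<in> space (P n). \<bar>X n y\<bar> > \<delta>}) \<longlonglongrightarrow> 0)"

lemma summable_block_weight:
  assumes "c > 0" shows "summable (block_weight c)"
proof (rule summable_comparison_test_ev)
  have "summable (\<lambda>k. exp (- c) ^ k)"
    using assms by (intro summable_geometric) auto
  then show "summable (\<lambda>k. exp (- c) ^ k)" .
  show "\<forall>\<^sub>F k in sequentially. norm (block_weight c k) \<le> exp (- c) ^ k"
    using eventually_ge_at_top[of 3]
  proof eventually_elim
    case (elim k)
    have "exp 1 \<le> real k" using elim exp_le by linarith
    then have "ln (real k) \<ge> 1" using elim by (simp add: ln_ge_iff)
    then have "c * real k * 1 \<le> c * real k * ln (real k)"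
      using assms by (intro mult_left_mono) auto
    then show ?case using elim
      by (simp add: block_weight_def mult.commute flip: exp_of_nat_mult)
  qed
qed

lemma pmf_block_count:
  assumes "c > 0"
  shows "pmf (block_count_pmf c) k = block_weight c k / (\<Sum>j. block_weight c j)"
proof -
  have nonneg: "block_weight c j \<ge> 0" for j by (simp add: block_weight_def)
  have "block_weight c 1 > 0" by (simp add: block_weight_def)
  then have pos: "(\<Sum>j. block_weight c j) > 0"
    using suminf_pos2[OF summable_block_weight[OF assms] nonneg] by blast
  show ?thesis unfolding block_count_pmf_def
  proof (rule pmf_embed_pmf)
    show "0 \<le> block_weight c x / (\<Sum>j. block_weight c j)" for x
      using nonneg pos by simp
    have "(\<integral>\<^sup>+ x. ennreal (block_weight c x / (\<Sum>j. block_weight c j)) \<partial>count_space UNIV)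
        = (\<Sum>x. ennreal (block_weight c x / (\<Sum>j. block_weight c j)))"
      by (rule nn_integral_count_space_nat)
    also have "\<dots> = ennreal (\<Sum>x. block_weight c x / (\<Sum>j. block_weight c j))"
      using nonneg pos summable_block_weight[OF assms]
      by (intro suminf_ennreal2) (auto intro: summable_divide)
    also have "(\<Sum>x. block_weight c x / (\<Sum>j. block_weight c j)) = 1"
      using pos summable_block_weight[OF assms] by (subst suminf_divide) auto
    finally show "(\<integral>\<^sup>+ x. ennreal (block_weight c x / (\<Sum>j. block_weight c j)) \<partial>count_space UNIV) = 1"
      by simp
  qed
qed

lemma space_step_space: "space step_space = eb_step_functions"
  by (simp add: step_space_def space_restrict_space space_PiM)

lemma measurable_eval_step_space [measurable]: "(\<lambda>f. f x) \<in> borel_measurable step_space"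
  unfolding step_space_def by (intro measurable_restrict_space1) measurable

lemma measurable_step_fun:
  "step_fun K (eb_cell K) \<in> (\<Pi>\<^sub>M k\<in>{1..K}. std_normal_distribution) \<rightarrow>\<^sub>M step_space"
  unfolding step_space_def
proof (rule measurable_restrict_space2)
  have "step_fun K (eb_cell K) \<beta> \<in> eb_step_functions" for \<beta>
  proof (cases "K = 0")
    case True
    then have "step_fun K (eb_cell K) \<beta> = step_fun 1 (eb_cell 1) (\<lambda>_. 0)"
      by (simp add: step_fun_def)
    then show ?thesis unfolding eb_step_functions_def by auto
  next
    case False
    then have "K \<in> {1..}" by simp
    then show ?thesis unfolding eb_step_functions_def by blast
  qed
  then show "step_fun K (eb_cell K) \<in> space (\<Pi>\<^sub>M k\<in>{1..K}. std_normal_distribution) \<rightarrow> eb_step_functions"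
    by auto
  show "step_fun K (eb_cell K) \<in> (\<Pi>\<^sub>M k\<in>{1..K}. std_normal_distribution) \<rightarrow>\<^sub>M (\<Pi>\<^sub>M x\<in>UNIV. borel)"
  proof (rule measurable_PiM_single')
    fix x :: real
    have "(\<lambda>\<beta>. \<beta> k) \<in> borel_measurable (\<Pi>\<^sub>M k\<in>{1..K}. std_normal_distribution)"
      if "k \<in> {1..K}" for k
      using measurable_component_singleton[OF that, of "\<lambda>_. std_normal_distribution"]
      by (simp add: measurable_def)
    then show "(\<lambda>\<beta>. step_fun K (eb_cell K) \<beta> x) \<in> borel_measurable (\<Pi>\<^sub>M k\<in>{1..K}. std_normal_distribution)"
      unfolding step_fun_def by (intro borel_measurable_sum borel_measurable_times) auto
  qed (auto simp: PiE_UNIV_domain)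
qed

lemma prior_kernel:
  "(\<lambda>K. distr (\<Pi>\<^sub>M k\<in>{1..K}. std_normal_distribution) step_space (step_fun K (eb_cell K)))
     \<in> measure_pmf p \<rightarrow>\<^sub>M prob_algebra step_space"
proof -
  have "prob_space (distr (\<Pi>\<^sub>M k\<in>{1..K}. std_normal_distribution) step_space (step_fun K (eb_cell K)))" for K :: nat
    by (intro prob_space.prob_space_distr measurable_step_fun prob_space_PiM)
       (auto intro: prob_space_normal_density)
  then show ?thesis
    by (auto simp: measurable_def space_prob_algebra)
qed

lemma
  shows prob_space_eb_prior: "prob_space (eb_prior c)"
    and sets_eb_prior [measurable_cong]: "sets (eb_prior c) = sets step_space"
    and space_eb_prior: "space (eb_prior c) = eb_step_functions"
proof -
  have "measure_pmf (block_count_pmf c) \<in> space (prob_algebra (measure_pmf (block_count_pmf c)))"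
    by (simp add: space_prob_algebra measure_pmf.prob_space_axioms)
  from prob_space_bind'[OF this prior_kernel] sets_bind'[OF this prior_kernel]
  show "prob_space (eb_prior c)" "sets (eb_prior c) = sets step_space"
    by (simp_all add: eb_prior_def)
  from sets_eq_imp_space_eq[OF this(2)] show "space (eb_prior c) = eb_step_functions"
    by (simp add: space_step_space)
qed

lemma sets_emp_norm_event:
  "{f \<in> eb_step_functions. emp_norm n (\<lambda>x. f x - f0 x) \<ge> r} \<in> sets (eb_prior c)"
proof -
  have "{f \<in> space (eb_prior c). emp_norm n (\<lambda>x. f x - f0 x) \<ge> r} \<in> sets (eb_prior c)"
    unfolding emp_norm_def by measurable
  then show ?thesis by (simp add: space_eb_prior)
qed

lemma prob_space_posterior: "prob_space (posterior (eb_prior c) n Y)"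
proof
  interpret prob_space "eb_prior c" by (rule prob_space_eb_prior)
  let ?Z = "\<integral>\<^sup>+ g. ennreal (likelihood n g Y) \<partial>eb_prior c"
  have [measurable]: "(\<lambda>g. likelihood n g Y) \<in> borel_measurable (eb_prior c)"
    unfolding likelihood_def normal_density_def by measurable
  have pos: "likelihood n g Y > 0" for g
    unfolding likelihood_def by (intro prod_pos) (auto intro: normal_density_pos)
  have "likelihood n g Y \<le> (\<Prod>i=1..n. 1 / sqrt (2 * pi))" for g
    unfolding likelihood_def by (intro prod_mono) (auto simp: normal_density_def divide_simps)
  then have "?Z \<le> (\<integral>\<^sup>+ g. ennreal (\<Prod>i=1..n. 1 / sqrt (2 * pi)) \<partial>eb_prior c)"
    by (intro nn_integral_mono ennreal_leI) auto
  also have "\<dots> < \<infinity>" by (simp add: emeasure_space_1 ennreal_mult_less_top)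
  finally have fin: "?Z < \<infinity>" .
  have "?Z \<noteq> 0"
  proof
    assume "?Z = 0"
    then have "AE g in eb_prior c. ennreal (likelihood n g Y) = 0"
      by (subst (asm) nn_integral_0_iff_AE) auto
    then have "AE g in eb_prior c. False"
      by eventually_elim (metis pos ennreal_eq_0_iff not_le)
    then show False by simp
  qed
  with fin have "?Z / ?Z = 1" by (intro ennreal_divide_self) auto
  then show "emeasure (posterior (eb_prior c) n Y) (space (posterior (eb_prior c) n Y)) = 1"
    unfolding posterior_def by (simp add: emeasure_density nn_integral_divide cong: nn_integral_cong)
qed

lemma measurable_posterior:
  assumes "A \<in> sets (eb_prior c)"
  shows "(\<lambda>Y. measure (posterior (eb_prior c) n Y) A) \<in> borel_measurable (obs_law n f0)"
proof -
  interpret prob_space "eb_prior c" by (rule prob_space_eb_prior)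
  note [measurable] = assms
  let ?O = "\<Pi>\<^sub>M i\<in>{1..n}. borel :: real measure"
  have L [measurable]: "(\<lambda>(Y, f). likelihood n f Y) \<in> borel_measurable (?O \<Otimes>\<^sub>M eb_prior c)"
    unfolding likelihood_def normal_density_def by measurable
  have [measurable]: "(\<lambda>g. likelihood n g Y) \<in> borel_measurable (eb_prior c)" for Y
    unfolding likelihood_def normal_density_def by measurable
  have "(\<lambda>Y. \<integral>\<^sup>+ f. ennreal (likelihood n f Y) / (\<integral>\<^sup>+ g. ennreal (likelihood n g Y) \<partial>eb_prior c)
       * indicator A f \<partial>eb_prior c) \<in> borel_measurable ?O"
    by measurable
  then have "(\<lambda>Y. measure (posterior (eb_prior c) n Y) A) \<in> borel_measurable ?O"
    by (simp add: measure_def posterior_def emeasure_density)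
  then show ?thesis by (simp add: obs_law_def)
qed

end

theory Submission
  imports Defs
begin

text \<open>
  Let \<open>s\<close> be the complexity of \<open>f0\<close>. On \<open>(0, 1]\<close>, which contains the design points, \<open>f0\<close> is a step
  function on \<open>s\<close> equispaced blocks. Write \<open>e\<close> for the noise vector and \<open>g = f - f0\<close>, evaluated at the
  design points. The likelihood ratio of \<open>f\<close> against \<open>f0\<close> is \<open>exp (\<langle>e, g\<rangle> - \<parallel>g\<parallel>\<^sup>2 / 2)\<close>. If \<open>f\<close> has \<open>K\<close>
  blocks, then \<open>g\<close> is constant on the at most \<open>K + s\<close> cells of the common refinement of the two
  partitions, whence \<open>\<bar>\<langle>e, g\<rangle>\<bar> \<le> \<parallel>g\<parallel>\<^sup>2 / 4 + T\<^sub>K\<close>, where \<open>T\<^sub>K\<close> is the squared length of the projection of \<open>e\<close>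
  onto the vectors constant on these cells (\<open>correlation_le_projection_energy\<close>). This uniform bound takes
  the place of the usual tests and entropy bounds.

  It has two consequences, valid for every noise vector. Functions with \<open>K\<close> blocks and \<open>\<parallel>g\<parallel>\<^sup>2 \<ge> R\<close> have
  likelihood ratio at most \<open>exp (T\<^sub>K - R / 4)\<close>. The evidence is, relative to the likelihood of \<open>f0\<close>, at
  least \<open>exp (- T\<^sub>K - 1)\<close> times the prior mass of a small box of step functions on \<open>s\<close> blocks around \<open>f0\<close>;
  with squared heights of order \<open>ln n\<close> this mass is at least \<open>exp (- C * s * ln n)\<close>
  (\<open>evidence_ge\<close>). So the part of the posterior mass of \<open>{f. \<parallel>f - f0\<parallel>\<^sup>2 \<ge> R}\<close> that belongs to \<open>K\<close> blocks is at
  most \<open>w\<^sub>K * exp (2 * T\<^sub>K + C * s * ln n - R / 4)\<close>, with \<open>w\<^sub>K\<close> the unnormalized prior weight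
  \<open>exp (- c * K * ln K)\<close>.

  Being also at most \<open>1\<close>, this part is bounded by the eighth root of that expression
  (\<open>emeasure_posterior_le\<close>), and \<open>exp (T\<^sub>K / 4)\<close> has expectation at most \<open>sqrt 2 ^ (K + s)\<close>
  (\<open>nn_integral_exp_projection_energy\<close>). Since \<open>w\<^sub>K\<close> decays faster than geometrically, the sum over all \<open>K\<close>
  of \<open>w\<^sub>K powr (1 / 8) * sqrt 2 ^ K\<close> is finite. The expected posterior
  mass is thus at most a constant times \<open>exp (C' * s * ln n - R / 32)\<close> (\<open>expected_posterior_mass_le\<close>). The
  theorem concerns \<open>R = M\<^sup>2 * s * ln (n / s)\<close>, and \<open>ln (n / s)\<close> is comparable to \<open>ln n\<close> for \<open>s\<close> of order at
  most \<open>sqrt n\<close>; hence a large \<open>M\<close> makes this bound tend to \<open>0\<close>, and Markov's inequality gives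
  convergence in probability.
\<close>

section \<open>Gaussian integrals\<close>

lemma sets_PiM_std_normal [measurable_cong]:
  "sets (\<Pi>\<^sub>M i\<in>I. std_normal_distribution) = sets (\<Pi>\<^sub>M i\<in>I. (borel :: real measure))"
  by (rule sets_PiM_cong) auto

lemma measurable_coordinate_std_normal:
  "i \<in> I \<Longrightarrow> (\<lambda>e. e i) \<in> borel_measurable (\<Pi>\<^sub>M i\<in>I. std_normal_distribution)"
  by (subst measurable_cong_sets[OF sets_PiM_std_normal refl]) (rule measurable_component_singleton)

lemma product_sigma_finite_std_normal: "product_sigma_finite (\<lambda>_. std_normal_distribution)"
  by (intro product_sigma_finite.intro prob_space_imp_sigma_finite prob_space_normal_density) simp

text \<open>Completing the square: tilting the standard normal density by \<open>exp (t * z)\<close> moves its mean to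
  \<open>t\<close>, up to the factor \<open>exp (t\<^sup>2 / 2)\<close>.\<close>

lemma nn_integral_exp_linear_std_normal:
  "(\<integral>\<^sup>+z. ennreal (exp (t * z)) \<partial>std_normal_distribution) = ennreal (exp (t\<^sup>2 / 2))"
proof -
  have shift: "std_normal_density z * exp (t * z) = exp (t\<^sup>2 / 2) * normal_density t 1 z" for z
    by (simp add: normal_density_def power2_eq_square field_simps flip: exp_add)
  have "(\<integral>\<^sup>+z. ennreal (exp (t * z)) \<partial>std_normal_distribution)
      = (\<integral>\<^sup>+z. ennreal (exp (t\<^sup>2 / 2)) * ennreal (normal_density t 1 z) \<partial>lborel)"
    by (subst nn_integral_density) (auto simp: shift simp flip: ennreal_mult)
  also have "\<dots> = ennreal (exp (t\<^sup>2 / 2))"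
    by (simp add: nn_integral_cmult nn_integral_eq_integral)
  finally show ?thesis .
qed

text \<open>Multiplying the standard normal density by \<open>exp (z\<^sup>2 / 4)\<close> turns the variance \<open>1\<close> into \<open>2\<close>, and
  the factor \<open>sqrt 2\<close> is the ratio of the normalizing constants.\<close>

lemma nn_integral_exp_square_std_normal:
  "(\<integral>\<^sup>+z. ennreal (exp (z\<^sup>2 / 4)) \<partial>std_normal_distribution) = ennreal (sqrt 2)"
proof -
  have widen: "std_normal_density z * exp (z\<^sup>2 / 4) = sqrt 2 * normal_density 0 (sqrt 2) z" for z
    by (simp add: normal_density_def real_sqrt_mult field_simps flip: exp_add)
  have "(\<integral>\<^sup>+z. ennreal (exp (z\<^sup>2 / 4)) \<partial>std_normal_distribution)
      = (\<integral>\<^sup>+z. ennreal (sqrt 2) * ennreal (normal_density 0 (sqrt 2) z) \<partial>lborel)"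
    by (subst nn_integral_density) (auto simp: widen simp flip: ennreal_mult)
  also have "\<dots> = ennreal (sqrt 2)"
    by (simp add: nn_integral_cmult nn_integral_eq_integral)
  finally show ?thesis .
qed

section \<open>Projection of Gaussian noise onto blockwise constant vectors\<close>

definition fiber :: "'i set \<Rightarrow> ('i \<Rightarrow> 'j) \<Rightarrow> 'j \<Rightarrow> 'i set" where
  "fiber I l j = {i \<in> I. l i = j}"

text \<open>The squared Euclidean norm of the orthogonal projection of \<open>e\<close> onto the space of the vectors
  that are constant on the fibers of \<open>l\<close>. Writing it through the fiber sums avoids all linear algebra.\<close>

definition projection_energy :: "'i set \<Rightarrow> ('i \<Rightarrow> 'j) \<Rightarrow> ('i \<Rightarrow> real) \<Rightarrow> real" where
  "projection_energy I l e =
     (\<Sum>j\<in>l ` I. (\<Sum>i\<in>fiber I l j. e i)\<^sup>2 / real (card (fiber I l j)))"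

lemma card_fiber_pos: "finite I \<Longrightarrow> j \<in> l ` I \<Longrightarrow> card (fiber I l j) > 0"
  by (auto simp: fiber_def card_gt_0_iff)

lemma sum_over_fibers:
  "finite I \<Longrightarrow> (\<Sum>i\<in>I. f i) = (\<Sum>j\<in>l ` I. \<Sum>i\<in>fiber I l j. (f i :: real))"
  unfolding fiber_def by (rule sum.image_gen)

text \<open>A vector \<open>g\<close> that is constant on the fibers only sees the projection of the noise, so its
  correlation with \<open>e\<close> is at most \<open>\<parallel>g\<parallel> * sqrt (projection_energy I l e)\<close>. The product is split by
  \<open>u * v \<le> u\<^sup>2 / 4 + v\<^sup>2\<close>; the weight \<open>1 / 4\<close> is smaller than the \<open>1 / 2\<close> with which \<open>\<parallel>g\<parallel>\<^sup>2\<close>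
  enters the logarithm of the Gaussian likelihood ratio. The bound is uniform in \<open>g\<close>.\<close>

lemma correlation_le_projection_energy:
  assumes "finite I"
    and const: "\<And>i j. i \<in> I \<Longrightarrow> j \<in> I \<Longrightarrow> l i = l j \<Longrightarrow> g i = g j"
  shows "\<bar>\<Sum>i\<in>I. e i * g i\<bar> \<le> (\<Sum>i\<in>I. (g i)\<^sup>2) / 4 + projection_energy I l e"
proof -
  define h where "h = g \<circ> inv_into I l"
  have g: "g i = h (l i)" if "i \<in> I" for i
    unfolding h_def comp_def using that
    by (intro const) (auto intro: inv_into_into simp: f_inv_into_f)
  let ?S = "\<lambda>j. \<Sum>i\<in>fiber I l j. e i" and ?c = "\<lambda>j. real (card (fiber I l j))"
  have per_fiber: "\<bar>?S j * h j\<bar> \<le> ?c j * (h j)\<^sup>2 / 4 + (?S j)\<^sup>2 / ?c j" if "j \<in> l ` I" for j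
  proof -
    have c: "?c j > 0" using card_fiber_pos[OF assms(1) that] by simp
    \<comment> \<open>AM-GM in the form of a square, with \<open>sqrt (?c j)\<close> normalizing the fiber sum to unit variance.\<close>
    have "0 \<le> (sqrt (?c j) * \<bar>h j\<bar> / 2 - \<bar>?S j\<bar> / sqrt (?c j))\<^sup>2" by simp
    also have "\<dots> = ?c j * (h j)\<^sup>2 / 4 + (?S j)\<^sup>2 / ?c j - \<bar>?S j * h j\<bar>"
      using c by (simp add: power2_diff power_mult_distrib power_divide abs_mult)
    finally show ?thesis by simp
  qed
  have "(\<Sum>i\<in>I. e i * g i) = (\<Sum>j\<in>l ` I. ?S j * h j)"
    unfolding sum_over_fibers[OF assms(1), of _ l] sum_distrib_right
    by (intro sum.cong refl) (auto simp: fiber_def g)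
  moreover have "(\<Sum>i\<in>I. (g i)\<^sup>2) = (\<Sum>j\<in>l ` I. ?c j * (h j)\<^sup>2)"
  proof -
    have "(\<Sum>i\<in>fiber I l j. (g i)\<^sup>2) = ?c j * (h j)\<^sup>2" for j
      by (subst sum.cong[OF refl, of _ _ "\<lambda>_. (h j)\<^sup>2"]) (auto simp: fiber_def g)
    then show ?thesis by (simp add: sum_over_fibers[OF assms(1), of _ l])
  qed
  moreover have "\<bar>\<Sum>j\<in>l ` I. ?S j * h j\<bar> \<le> (\<Sum>j\<in>l ` I. ?c j * (h j)\<^sup>2 / 4 + (?S j)\<^sup>2 / ?c j)"
    by (rule order_trans[OF sum_abs]) (intro sum_mono per_fiber)
  ultimately show ?thesis
    by (simp add: projection_energy_def sum.distrib sum_divide_distrib)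
qed

lemma measurable_projection_energy [measurable]:
  "finite I \<Longrightarrow> projection_energy I l \<in> borel_measurable (\<Pi>\<^sub>M i\<in>I. borel)"
  unfolding projection_energy_def[abs_def]
  by (intro borel_measurable_sum borel_measurable_divide borel_measurable_power
      borel_measurable_const measurable_component_singleton) (auto simp: fiber_def)

text \<open>The energy is a sum of squares of as many independent standard normal variables as there are
  nonempty fibers. The expectation is found by mixing: \<open>exp (x\<^sup>2 / 4)\<close> is the mixture of the
  exponentials \<open>exp (x * z / sqrt 2)\<close> over a standard normal \<open>z\<close>, and after an exchange of the two
  integrals both of them factorize.\<close>

lemma nn_integral_exp_projection_energy:
  assumes "finite I"
  shows "(\<integral>\<^sup>+e. ennreal (exp (projection_energy I l e / 4)) \<partial>(\<Pi>\<^sub>M i\<in>I. std_normal_distribution))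
    = ennreal (sqrt 2 ^ card (l ` I))"
proof -
  interpret product_sigma_finite "\<lambda>_. std_normal_distribution"
    by (rule product_sigma_finite_std_normal)
  let ?J = "l ` I" and ?c = "\<lambda>j. real (card (fiber I l j))"
  let ?N = "\<lambda>A. \<Pi>\<^sub>M i\<in>A. std_normal_distribution"
  interpret P: pair_sigma_finite "?N I" "?N ?J"
    by (intro pair_sigma_finite.intro sigma_finite) (use assms in auto)
  \<comment> \<open>One mixing variable \<open>z j\<close> per fiber; \<open>F\<close> is bilinear and is read as a sum over the fibers when
    integrating over \<open>z\<close> and as a sum over \<open>I\<close> when integrating over \<open>e\<close>.\<close>
  define F where "F e z = (\<Sum>i\<in>I. e i * (z (l i) / sqrt (2 * ?c (l i))))"
    for e :: "'a \<Rightarrow> real" and z :: "'b \<Rightarrow> real"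
  have F_fibers: "F e z = (\<Sum>j\<in>?J. (\<Sum>i\<in>fiber I l j. e i) / sqrt (2 * ?c j) * z j)" for e z
    unfolding F_def sum_over_fibers[OF assms, of _ l] sum_divide_distrib sum_distrib_right
    by (intro sum.cong refl) (auto simp: fiber_def)
  have [measurable]: "(\<lambda>p. F (fst p) (snd p)) \<in> borel_measurable (?N I \<Otimes>\<^sub>M ?N ?J)"
    unfolding F_def
    by (intro borel_measurable_sum borel_measurable_times borel_measurable_divide borel_measurable_const
        measurable_compose[OF measurable_fst] measurable_compose[OF measurable_snd])
      (auto intro!: measurable_coordinate_std_normal)
  have mix: "ennreal (exp (projection_energy I l e / 4)) = (\<integral>\<^sup>+z. ennreal (exp (F e z)) \<partial>?N ?J)" for e
  proof -
    let ?t = "\<lambda>j. (\<Sum>i\<in>fiber I l j. e i) / sqrt (2 * ?c j)"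
    have "(\<integral>\<^sup>+z. ennreal (exp (F e z)) \<partial>?N ?J)
        = (\<integral>\<^sup>+z. (\<Prod>j\<in>?J. ennreal (exp (?t j * z j))) \<partial>?N ?J)"
      by (simp add: F_fibers exp_sum assms prod_ennreal)
    also have "\<dots> = (\<Prod>j\<in>?J. ennreal (exp ((?t j)\<^sup>2 / 2)))"
      using assms
      by (subst product_nn_integral_prod) (auto simp: nn_integral_exp_linear_std_normal
          simp del: times_divide_eq_left times_divide_eq_right)
    also have "\<dots> = ennreal (exp (\<Sum>j\<in>?J. (?t j)\<^sup>2 / 2))"
      by (simp add: prod_ennreal exp_sum assms)
    also have "(\<Sum>j\<in>?J. (?t j)\<^sup>2 / 2) = projection_energy I l e / 4"
      unfolding projection_energy_def sum_divide_distrib[of _ ?J]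
      by (intro sum.cong refl) (simp add: power_divide mult.commute)
    finally show ?thesis ..
  qed
  have inner: "(\<integral>\<^sup>+e. ennreal (exp (F e z)) \<partial>?N I) = (\<Prod>j\<in>?J. ennreal (exp ((z j)\<^sup>2 / 4)))" for z
  proof -
    have "(\<integral>\<^sup>+e. ennreal (exp (F e z)) \<partial>?N I)
        = (\<integral>\<^sup>+e. (\<Prod>i\<in>I. ennreal (exp (z (l i) / sqrt (2 * ?c (l i)) * e i))) \<partial>?N I)"
      by (simp add: F_def exp_sum assms prod_ennreal mult.commute)
    also have "\<dots> = (\<Prod>i\<in>I. ennreal (exp ((z (l i) / sqrt (2 * ?c (l i)))\<^sup>2 / 2)))"
      using assms
      by (subst product_nn_integral_prod) (auto simp: nn_integral_exp_linear_std_normal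
          simp del: times_divide_eq_left times_divide_eq_right)
    also have "\<dots> = ennreal (exp (\<Sum>i\<in>I. (z (l i))\<^sup>2 / (4 * ?c (l i))))"
      by (simp add: prod_ennreal exp_sum assms power_divide)
    also have "(\<Sum>i\<in>I. (z (l i))\<^sup>2 / (4 * ?c (l i))) = (\<Sum>j\<in>?J. \<Sum>i\<in>fiber I l j. (z j)\<^sup>2 / (4 * ?c j))"
      unfolding sum_over_fibers[OF assms, of _ l]
      by (intro sum.cong refl) (auto simp: fiber_def)
    also have "\<dots> = (\<Sum>j\<in>?J. (z j)\<^sup>2 / 4)"
      using card_fiber_pos[OF assms, of _ l] by (intro sum.cong refl) (auto simp: field_simps)
    finally show ?thesis by (simp add: exp_sum assms prod_ennreal)
  qed
  have "(\<integral>\<^sup>+e. ennreal (exp (projection_energy I l e / 4)) \<partial>?N I)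
      = (\<integral>\<^sup>+z. (\<integral>\<^sup>+e. ennreal (exp (F e z)) \<partial>?N I) \<partial>?N ?J)"
    unfolding mix by (rule P.Fubini'[symmetric]) (simp add: case_prod_beta')
  also have "\<dots> = (\<integral>\<^sup>+z. (\<Prod>j\<in>?J. ennreal (exp ((z j)\<^sup>2 / 4))) \<partial>?N ?J)"
    unfolding inner ..
  also have "\<dots> = ennreal (sqrt 2 ^ card ?J)"
    using assms
    by (subst product_nn_integral_prod) (auto simp: nn_integral_exp_square_std_normal ennreal_power)
  finally show ?thesis .
qed

section \<open>Equispaced blocks and their common refinement\<close>

definition block_index :: "nat \<Rightarrow> real \<Rightarrow> nat" where
  "block_index K x = nat \<lceil>real K * x\<rceil>"

lemma block_index_mono: "x \<le> y \<Longrightarrow> block_index K x \<le> block_index K y"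
  unfolding block_index_def by (intro nat_mono ceiling_mono mult_left_mono) auto

lemma block_index_le: "x \<le> 1 \<Longrightarrow> block_index K x \<le> K"
  using block_index_mono[of x 1 K] by (simp add: block_index_def)

lemma block_index_pos: "0 < x \<Longrightarrow> 1 \<le> K \<Longrightarrow> 1 \<le> block_index K x"
  by (simp add: block_index_def Suc_le_eq)

lemma mem_eb_cell_iff:
  assumes "1 \<le> k" "1 \<le> K"
  shows "x \<in> eb_cell K k \<longleftrightarrow> block_index K x = k"
proof -
  have "x \<in> eb_cell K k \<longleftrightarrow> real k - 1 < real K * x \<and> real K * x \<le> real k"
    using assms by (simp add: eb_cell_def field_simps)
  also have "\<dots> \<longleftrightarrow> \<lceil>real K * x\<rceil> = int k"
    by (auto simp: ceiling_eq_iff)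
  also have "\<dots> \<longleftrightarrow> block_index K x = k"
    using assms by (auto simp: block_index_def)
  finally show ?thesis .
qed

text \<open>The case \<open>K = 0\<close>, the zero function, has prior weight \<open>0\<close>; including it lets all later
  bounds hold for every term of a series over \<open>K\<close>.\<close>

lemma step_fun_eb_cell:
  assumes "0 < x" "x \<le> 1"
  shows "step_fun K (eb_cell K) \<beta> x = (if K = 0 then 0 else \<beta> (block_index K x))"
proof (cases "K = 0")
  case False
  then have K: "block_index K x \<in> {1..K}"
    using assms block_index_le block_index_pos by simp
  have "step_fun K (eb_cell K) \<beta> x = (\<Sum>k=1..K. if k = block_index K x then \<beta> k else 0)"
    unfolding step_fun_def using False
    by (intro sum.cong refl) (auto simp: indicator_def mem_eb_cell_iff)
  then show ?thesis using K False by simp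
qed (simp add: step_fun_def)

text \<open>An equispaced cell that meets exactly one cell of a representing partition lies inside it, so on
  the cells of the equispaced partition that attains the complexity the function is constant, with
  heights taken from the original ones.\<close>

lemma blockwise_constant_of_complexity:
  assumes rep: "represents f K0 \<Omega> \<beta>0"
    and cplx: "complexity K0 \<Omega> eb_partitions = enat s"
  shows "s \<ge> 1 \<and> (\<exists>\<beta>.
    (\<forall>x. 0 < x \<longrightarrow> x \<le> 1 \<longrightarrow> f x = \<beta> (block_index s x)) \<and>
    (\<forall>k\<in>{1..s}. \<bar>\<beta> k\<bar> \<le> (MAX k\<in>{1..K0}. \<bar>\<beta>0 k\<bar>)))"
proof -
  let ?S = "{enat K | K \<Omega>'. (K, \<Omega>') \<in> eb_partitions \<and> (\<forall>k\<in>{1..K}. cells_met (\<Omega>' k) K0 \<Omega> = 1)}"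
  have cplx': "Inf ?S = enat s" using cplx unfolding complexity_def .
  have "?S \<noteq> {}"
  proof
    assume "?S = {}"
    then have "Inf ?S = \<infinity>" by (simp add: Inf_enat_def del: Collect_empty_eq)
    then show False using cplx' by simp
  qed
  then obtain y where "y \<in> ?S" by blast
  then have "(LEAST y. y \<in> ?S) \<in> ?S" by (rule LeastI)
  then have "enat s \<in> ?S"
    unfolding cplx'[symmetric] using \<open>?S \<noteq> {}\<close> by (simp only: Inf_enat_def if_False)
  then have s: "s \<ge> 1" and met: "\<And>k. k \<in> {1..s} \<Longrightarrow> cells_met (eb_cell s k) K0 \<Omega> = 1"
    by (auto simp: eb_partitions_def)
  have "\<forall>k\<in>{1..s}. \<exists>j. j \<in> {1..K0} \<and> {i\<in>{1..K0}. \<Omega> i \<inter> eb_cell s k \<noteq> {}} = {j}"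
  proof
    fix k assume "k \<in> {1..s}"
    then have "card {i\<in>{1..K0}. \<Omega> i \<inter> eb_cell s k \<noteq> {}} = 1"
      using met unfolding cells_met_def by blast
    then obtain j where j: "{i\<in>{1..K0}. \<Omega> i \<inter> eb_cell s k \<noteq> {}} = {j}"
      by (rule card_1_singletonE)
    then have "j \<in> {i\<in>{1..K0}. \<Omega> i \<inter> eb_cell s k \<noteq> {}}" by (simp only: singletonI)
    with j show "\<exists>j. j \<in> {1..K0} \<and> {i\<in>{1..K0}. \<Omega> i \<inter> eb_cell s k \<noteq> {}} = {j}" by blast
  qed
  from bchoice[OF this] obtain j where
    "\<forall>k\<in>{1..s}. j k \<in> {1..K0} \<and> {i\<in>{1..K0}. \<Omega> i \<inter> eb_cell s k \<noteq> {}} = {j k}" ..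
  then have j: "j k \<in> {1..K0}" "{i\<in>{1..K0}. \<Omega> i \<inter> eb_cell s k \<noteq> {}} = {j k}"
    if "k \<in> {1..s}" for k using that by blast+
  show ?thesis
  proof (intro conjI s exI[of _ "\<beta>0 \<circ> j"] allI impI ballI)
    fix x :: real assume x: "0 < x" "x \<le> 1"
    let ?k = "block_index s x"
    have k: "?k \<in> {1..s}" using x s block_index_le block_index_pos by simp
    have "x \<in> eb_cell s ?k" using k s by (subst mem_eb_cell_iff) auto
    then have only: "i = j ?k" if "i \<in> {1..K0}" "x \<in> \<Omega> i" for i
      using that j(2)[OF k] by auto
    have part: "interval_partition K0 \<Omega>" "f x = step_fun K0 \<Omega> \<beta>0 x"
      using rep x by (auto simp: represents_def)
    have "x \<in> (\<Union>i\<in>{1..K0}. \<Omega> i)" using part(1) x by (auto simp: interval_partition_def)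
    then have mem: "i \<in> {1..K0} \<Longrightarrow> x \<in> \<Omega> i \<longleftrightarrow> i = j ?k" for i using only by blast
    have "step_fun K0 \<Omega> \<beta>0 x = (\<Sum>i=1..K0. if i = j ?k then \<beta>0 i else 0)"
      unfolding step_fun_def by (intro sum.cong refl) (auto simp: indicator_def mem)
    then show "f x = (\<beta>0 \<circ> j) ?k" using j(1)[OF k] part(2) by simp
  next
    fix k assume "k \<in> {1..s}"
    then show "\<bar>(\<beta>0 \<circ> j) k\<bar> \<le> (MAX k\<in>{1..K0}. \<bar>\<beta>0 k\<bar>)"
      using j(1) by (intro Max_ge) auto
  qed
qed

text \<open>Labels the cells of the common refinement of the partitions into \<open>K\<close> and \<open>s\<close> blocks. The sum
  of the two block indices suffices as a label because both are monotone in the design point, and it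
  shows at once that the refinement has at most \<open>K + s\<close> cells.\<close>

definition refinement_label :: "nat \<Rightarrow> nat \<Rightarrow> nat \<Rightarrow> nat \<Rightarrow> nat" where
  "refinement_label n K s i = block_index K (real i / real n) + block_index s (real i / real n)"

lemma refinement_label_eqD:
  assumes "refinement_label n K s i = refinement_label n K s j"
  shows "block_index K (real i / real n) = block_index K (real j / real n)"
    and "block_index s (real i / real n) = block_index s (real j / real n)"
proof -
  \<comment> \<open>Both indices move in the same direction, so neither can change if their sum does not.\<close>
  have "block_index K (real i / real n) = block_index K (real j / real n) \<and>
        block_index s (real i / real n) = block_index s (real j / real n)"
  proof (cases i j rule: linorder_le_cases)
    case le
    then have "real i / real n \<le> real j / real n" by (intro divide_right_mono) auto
    from block_index_mono[OF this, of K] block_index_mono[OF this, of s]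
    show ?thesis using assms by (simp add: refinement_label_def)
  next
    case ge
    then have "real j / real n \<le> real i / real n" by (intro divide_right_mono) auto
    from block_index_mono[OF this, of K] block_index_mono[OF this, of s]
    show ?thesis using assms by (simp add: refinement_label_def)
  qed
  then show "block_index K (real i / real n) = block_index K (real j / real n)"
    "block_index s (real i / real n) = block_index s (real j / real n)" by auto
qed

lemma card_refinement_label:
  assumes "s \<ge> 1"
  shows "card (refinement_label n K s ` {1..n}) \<le> K + s"
proof -
  have "refinement_label n K s ` {1..n} \<subseteq> {1..K + s}"
  proof safe
    fix i assume i: "i \<in> {1..n}"
    then have "0 < real i / real n" "real i / real n \<le> 1" by auto
    with assms block_index_le[of "real i / real n" K] block_index_le[of "real i / real n" s]
      block_index_pos[of "real i / real n" s]
    show "refinement_label n K s i \<in> {1..K + s}" by (simp add: refinement_label_def)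
  qed
  then show ?thesis using card_mono[of "{1..K + s}"] by simp
qed

section \<open>Observations, likelihood and prior\<close>

definition observe :: "nat \<Rightarrow> (real \<Rightarrow> real) \<Rightarrow> (nat \<Rightarrow> real) \<Rightarrow> nat \<Rightarrow> real" where
  "observe n f e = (\<lambda>i\<in>{1..n}. f (real i / real n) + e i)"

lemma measurable_observe:
  "observe n f \<in> (\<Pi>\<^sub>M i\<in>{1..n}. std_normal_distribution) \<rightarrow>\<^sub>M (\<Pi>\<^sub>M i\<in>{1..n}. borel)"
  unfolding observe_def[abs_def]
  by (intro measurable_restrict borel_measurable_add borel_measurable_const
      measurable_coordinate_std_normal)

lemma nn_integral_obs_law:
  assumes "u \<in> borel_measurable (\<Pi>\<^sub>M i\<in>{1..n}. borel)"
  shows "(\<integral>\<^sup>+Y. u Y \<partial>obs_law n f)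
    = (\<integral>\<^sup>+e. u (observe n f e) \<partial>(\<Pi>\<^sub>M i\<in>{1..n}. std_normal_distribution))"
proof -
  have "obs_law n f = distr (\<Pi>\<^sub>M i\<in>{1..n}. std_normal_distribution) (\<Pi>\<^sub>M i\<in>{1..n}. borel) (observe n f)"
    by (simp add: obs_law_def observe_def[abs_def])
  then show ?thesis
    using assms by (simp only: nn_integral_distr[OF measurable_observe] measurable_distr_eq1)
qed

abbreviation sq_dist :: "nat \<Rightarrow> (real \<Rightarrow> real) \<Rightarrow> (real \<Rightarrow> real) \<Rightarrow> real" where
  "sq_dist n f g \<equiv> (\<Sum>i=1..n. (f (real i / real n) - g (real i / real n))\<^sup>2)"

lemma likelihood_pos: "likelihood n f Y > 0"
  unfolding likelihood_def by (intro prod_pos) (auto intro: normal_density_pos)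

text \<open>The residual of \<open>f\<close> is \<open>e - (f - f0)\<close>; expanding its square leaves the residual \<open>e\<close> of \<open>f0\<close> and the
  terms in the exponent.\<close>

lemma likelihood_observe:
  "likelihood n f (observe n f0 e) = likelihood n f0 (observe n f0 e) *
     exp ((\<Sum>i=1..n. e i * (f (real i / real n) - f0 (real i / real n))) - sq_dist n f f0 / 2)"
proof -
  let ?x = "\<lambda>i. real i / real n"
  have "normal_density (f (?x i)) 1 (f0 (?x i) + e i) = normal_density (f0 (?x i)) 1 (f0 (?x i) + e i)
      * exp (e i * (f (?x i) - f0 (?x i)) - (f (?x i) - f0 (?x i))\<^sup>2 / 2)" for i
    by (simp add: normal_density_def power2_eq_square field_simps flip: exp_add)
  then have "likelihood n f (observe n f0 e) = likelihood n f0 (observe n f0 e) *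
      (\<Prod>i=1..n. exp (e i * (f (?x i) - f0 (?x i)) - (f (?x i) - f0 (?x i))\<^sup>2 / 2))"
    by (simp add: likelihood_def observe_def prod.distrib)
  then show ?thesis by (simp add: exp_sum[symmetric] sum_subtractf sum_divide_distrib)
qed

lemma nn_integral_eb_prior:
  assumes c: "c > 0" and F: "F \<in> borel_measurable step_space"
  shows "(\<integral>\<^sup>+f. F f \<partial>eb_prior c) = (\<Sum>K. ennreal (block_weight c K / (\<Sum>j. block_weight c j)) *
     (\<integral>\<^sup>+\<beta>. F (step_fun K (eb_cell K) \<beta>) \<partial>(\<Pi>\<^sub>M k\<in>{1..K}. std_normal_distribution)))"
proof -
  have "(\<integral>\<^sup>+f. F f \<partial>eb_prior c)
      = (\<integral>\<^sup>+K. (\<integral>\<^sup>+\<beta>. F (step_fun K (eb_cell K) \<beta>) \<partial>(\<Pi>\<^sub>M k\<in>{1..K}. std_normal_distribution))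
           \<partial>measure_pmf (block_count_pmf c))"
    unfolding eb_prior_def
    by (subst nn_integral_bind[OF F measurable_prob_algebraD[OF prior_kernel]])
      (intro nn_integral_cong nn_integral_distr[OF measurable_step_fun], simp add: F)
  then show ?thesis
    by (simp add: nn_integral_measure_pmf nn_integral_count_space_nat pmf_block_count[OF c])
qed

lemma measurable_likelihood [measurable]:
  "(\<lambda>f. likelihood n f Y) \<in> borel_measurable step_space"
  unfolding likelihood_def normal_density_def by measurable

text \<open>A crude bound by length times minimal density. What matters is that it is \<open>exp (- b\<^sup>2 - O(1))\<close> times
  the length, uniformly for centres in \<open>{- b..b}\<close>.\<close>

lemma emeasure_std_normal_interval_ge:
  assumes "0 \<le> \<delta>" "\<delta> \<le> 1" "\<bar>a\<bar> \<le> b"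
  shows "emeasure std_normal_distribution {a - \<delta>..a + \<delta>} \<ge> ennreal (\<delta> * exp (- b\<^sup>2 - 2))"
proof -
  have low: "exp (- b\<^sup>2 - 2) / 2 \<le> std_normal_density z" if z: "z \<in> {a - \<delta>..a + \<delta>}" for z
  proof -
    have "sqrt (2 * pi) \<le> 2 * exp 1"
    proof (rule real_le_lsqrt)
      have "exp 1 \<ge> (2::real)" using exp_ge_add_one_self[of 1] by simp
      then have "(2 * exp 1)\<^sup>2 \<ge> (4::real)\<^sup>2" by (intro power_mono) auto
      then show "2 * pi \<le> (2 * exp 1)\<^sup>2" using pi_less_4 by simp
    qed auto
    then have scale: "exp (- 1) / 2 \<le> 1 / sqrt (2 * pi)"
      by (simp add: exp_minus divide_simps)
    have "\<bar>z - a\<bar> \<le> 1" using z assms by auto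
    then have "(z - a)\<^sup>2 \<le> 1" by (simp add: abs_square_le_1)
    moreover have "a\<^sup>2 \<le> b\<^sup>2" using power_mono[OF assms(3) abs_ge_zero, of 2] by simp
    moreover have "z\<^sup>2 \<le> 2 * a\<^sup>2 + 2 * (z - a)\<^sup>2"
      using zero_le_power2[of "2 * a - z"] by (simp add: power2_eq_square algebra_simps)
    ultimately have "exp (- b\<^sup>2 - 1) \<le> exp (- z\<^sup>2 / 2)" by simp
    then have "exp (- 1) / 2 * exp (- b\<^sup>2 - 1) \<le> 1 / sqrt (2 * pi) * exp (- z\<^sup>2 / 2)"
      using scale by (intro mult_mono) auto
    also have "exp (- 1) / 2 * exp (- b\<^sup>2 - 1) = exp (- b\<^sup>2 - 2) / 2"
      by (simp flip: exp_add)
    finally show ?thesis unfolding std_normal_density_def .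
  qed
  have "ennreal (\<delta> * exp (- b\<^sup>2 - 2)) = ennreal (exp (- b\<^sup>2 - 2) / 2) * ennreal (2 * \<delta>)"
    using assms by (simp flip: ennreal_mult)
  also have "\<dots> = (\<integral>\<^sup>+z. ennreal (exp (- b\<^sup>2 - 2) / 2) * indicator {a - \<delta>..a + \<delta>} z \<partial>lborel)"
    using assms by (subst nn_integral_cmult_indicator) auto
  also have "\<dots> \<le> (\<integral>\<^sup>+z. ennreal (std_normal_density z) * indicator {a - \<delta>..a + \<delta>} z \<partial>lborel)"
    using low by (intro nn_integral_mono) (force simp: indicator_def intro!: ennreal_leI)
  also have "\<dots> = emeasure std_normal_distribution {a - \<delta>..a + \<delta>}"
    by (subst emeasure_density) auto
  finally show ?thesis .
qed

section \<open>Likelihood bounds and the evidence\<close>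

lemma likelihood_nonneg: "likelihood n f Y \<ge> 0"
  by (rule less_imp_le[OF likelihood_pos])

text \<open>Both a function with \<open>K\<close> blocks and one with \<open>s\<close> blocks differ from \<open>f0\<close> by a function that is
  constant on the common refinement. One and the same energy \<open>T\<close> therefore controls the likelihood of
  every competitor with \<open>K\<close> blocks from above and, for the evidence, that of the functions with the
  block structure of \<open>f0\<close> from below.\<close>

lemma likelihood_bounds_by_energy:
  fixes n s K :: nat and e \<beta> \<beta>' :: "nat \<Rightarrow> real" and f0 :: "real \<Rightarrow> real"
  assumes s: "s \<ge> 1" and k: "k = K \<or> k = s"
    and f0: "\<And>x. 0 < x \<Longrightarrow> x \<le> 1 \<Longrightarrow> f0 x = \<beta> (block_index s x)"
  defines "f \<equiv> step_fun k (eb_cell k) \<beta>'"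
    and "T \<equiv> projection_energy {1..n} (refinement_label n K s) e"
    and "L \<equiv> \<lambda>f. likelihood n f (observe n f0 e)"
  shows "L f \<le> L f0 * exp (T - sq_dist n f f0 / 4)"
    and "L f0 * exp (- T - 3 / 4 * sq_dist n f f0) \<le> L f"
proof -
  let ?g = "\<lambda>i. f (real i / real n) - f0 (real i / real n)"
  have "\<bar>\<Sum>i=1..n. e i * ?g i\<bar> \<le> sq_dist n f f0 / 4 + T"
    unfolding T_def
  proof (rule correlation_le_projection_energy)
    fix i j assume "i \<in> {1..n}" "j \<in> {1..n}"
      and eq: "refinement_label n K s i = refinement_label n K s j"
    then have x: "0 < real i / real n" "real i / real n \<le> 1" "0 < real j / real n" "real j / real n \<le> 1"
      by auto
    have "block_index k (real i / real n) = block_index k (real j / real n)"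
      using k refinement_label_eqD[OF eq] by blast
    then show "?g i = ?g j"
      by (simp only: f_def step_fun_eb_cell x f0 refinement_label_eqD(2)[OF eq])
  qed simp
  then have upper: "(\<Sum>i=1..n. e i * ?g i) - sq_dist n f f0 / 2 \<le> T - sq_dist n f f0 / 4"
    and lower: "- T - 3 / 4 * sq_dist n f f0 \<le> (\<Sum>i=1..n. e i * ?g i) - sq_dist n f f0 / 2"
    by linarith+
  show "L f \<le> L f0 * exp (T - sq_dist n f f0 / 4)"
    and "L f0 * exp (- T - 3 / 4 * sq_dist n f f0) \<le> L f"
    unfolding L_def likelihood_observe[of n f] using upper lower
    by (auto intro!: mult_left_mono likelihood_nonneg)
qed

lemma block_weight_nonneg: "block_weight c k \<ge> 0"
  by (simp add: block_weight_def)

lemma suminf_block_weight_pos: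
  assumes "c > 0" shows "(\<Sum>j. block_weight c j) > 0"
  using suminf_pos2[OF summable_block_weight[OF assms] block_weight_nonneg, of 1]
  by (simp add: block_weight_def)

text \<open>Only the prior mass with the true number \<open>s\<close> of blocks and all heights within \<open>1 / sqrt n\<close> of the
  true ones is kept. This radius makes the squared distance to \<open>f0\<close> at most \<open>1\<close>, while each of the \<open>s\<close>
  heights costs a factor \<open>exp (- (ln n / 2 + b\<^sup>2 + 2))\<close> of prior mass. The bound holds for every noise
  vector, and the free parameter \<open>K\<close> allows the comparison with competitors having \<open>K\<close> blocks.\<close>

lemma evidence_ge:
  fixes n s K :: nat and e \<beta> :: "nat \<Rightarrow> real" and f0 :: "real \<Rightarrow> real"
  assumes c: "c > 0" and n: "n \<ge> 1" and s: "s \<ge> 1"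
    and f0: "\<And>x. 0 < x \<Longrightarrow> x \<le> 1 \<Longrightarrow> f0 x = \<beta> (block_index s x)"
    and b: "\<And>k. k \<in> {1..s} \<Longrightarrow> \<bar>\<beta> k\<bar> \<le> b"
  defines "T \<equiv> projection_energy {1..n} (refinement_label n K s) e"
    and "L \<equiv> \<lambda>f. likelihood n f (observe n f0 e)"
  shows "ennreal (block_weight c s / (\<Sum>j. block_weight c j) *
      (exp (- real s * (ln (real n) / 2 + b\<^sup>2 + 2)) * (L f0 * exp (- T - 1))))
    \<le> (\<integral>\<^sup>+f. ennreal (L f) \<partial>eb_prior c)"
proof -
  interpret product_sigma_finite "\<lambda>_. std_normal_distribution"
    by (rule product_sigma_finite_std_normal)
  let ?\<delta> = "1 / sqrt (real n)" and ?N = "\<Pi>\<^sub>M k\<in>{1..s}. std_normal_distribution"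
  let ?box = "\<Pi>\<^sub>E k\<in>{1..s}. {\<beta> k - ?\<delta>..\<beta> k + ?\<delta>}"
  let ?l = "L f0 * exp (- T - 1)"
  have sets: "?box \<in> sets ?N" by (intro sets_PiM_I_finite) auto
  have ln_\<delta>: "ln ?\<delta> = - (ln (real n) / 2)"
    using n by (simp add: ln_div ln_sqrt)
  have \<delta>: "?\<delta> = exp (- (ln (real n) / 2))"
    unfolding ln_\<delta>[symmetric] using n by (intro exp_ln[symmetric]) simp
  have "- real s * (ln (real n) / 2 + b\<^sup>2 + 2) = real s * (- (ln (real n) / 2) + (- b\<^sup>2 - 2))"
    by (simp add: algebra_simps)
  then have "exp (- real s * (ln (real n) / 2 + b\<^sup>2 + 2)) = (?\<delta> * exp (- b\<^sup>2 - 2)) ^ s"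
    unfolding \<delta> exp_add[symmetric] exp_of_nat_mult[symmetric] by (rule arg_cong)
  then have "ennreal (exp (- real s * (ln (real n) / 2 + b\<^sup>2 + 2)))
      = (\<Prod>k\<in>{1..s}. ennreal (?\<delta> * exp (- b\<^sup>2 - 2)))"
    by (simp only: prod_constant ennreal_power card_atLeastAtMost diff_Suc_1 Suc_eq_plus1 add_diff_cancel_right')
      (simp add: ennreal_power)
  also have "\<dots> \<le> (\<Prod>k\<in>{1..s}. emeasure std_normal_distribution {\<beta> k - ?\<delta>..\<beta> k + ?\<delta>})"
    using n b by (intro prod_mono_ennreal emeasure_std_normal_interval_ge) auto
  also have "\<dots> = emeasure ?N ?box"
    by (subst emeasure_PiM) auto
  finally have mass: "ennreal (exp (- real s * (ln (real n) / 2 + b\<^sup>2 + 2))) \<le> emeasure ?N ?box" .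
  have "?l \<le> L (step_fun s (eb_cell s) \<beta>')" if \<beta>': "\<beta>' \<in> ?box" for \<beta>'
  proof -
    let ?f = "step_fun s (eb_cell s) \<beta>'"
    have "(?f (real i / real n) - f0 (real i / real n))\<^sup>2 \<le> 1 / real n" if "i \<in> {1..n}" for i
    proof -
      have x: "0 < real i / real n" "real i / real n \<le> 1" using that by auto
      let ?k = "block_index s (real i / real n)"
      have "?k \<in> {1..s}" using s x block_index_le block_index_pos by simp
      from PiE_mem[OF \<beta>' this] have "\<bar>\<beta>' ?k - \<beta> ?k\<bar> \<le> ?\<delta>"
        unfolding atLeastAtMost_iff abs_le_iff by linarith
      then have "\<bar>\<beta>' ?k - \<beta> ?k\<bar>\<^sup>2 \<le> ?\<delta>\<^sup>2" by (intro power_mono) auto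
      moreover have "?f (real i / real n) - f0 (real i / real n) = \<beta>' ?k - \<beta> ?k"
        unfolding step_fun_eb_cell[OF x] f0[OF x] using s by simp
      ultimately show ?thesis by (simp add: power_divide)
    qed
    then have "sq_dist n ?f f0 \<le> (\<Sum>i=1..n. 1 / real n)" by (rule sum_mono)
    also have "\<dots> = 1" using n by simp
    finally have "- T - 1 \<le> - T - 3 / 4 * sq_dist n ?f f0" by simp
    then have "?l \<le> L f0 * exp (- T - 3 / 4 * sq_dist n ?f f0)"
      unfolding L_def by (intro mult_left_mono likelihood_nonneg) auto
    also have "\<dots> \<le> L ?f"
      unfolding T_def L_def by (rule likelihood_bounds_by_energy(2)[where ?f0.0 = f0 and \<beta> = \<beta>, OF s _ f0]) auto
    finally show ?thesis .
  qed
  then have "ennreal ?l * emeasure ?N ?box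
      \<le> (\<integral>\<^sup>+\<beta>'. ennreal (L (step_fun s (eb_cell s) \<beta>')) \<partial>?N)"
    unfolding nn_integral_cmult_indicator[OF sets, symmetric]
    by (intro nn_integral_mono) (auto simp: indicator_def intro!: ennreal_leI)
  then have "ennreal (exp (- real s * (ln (real n) / 2 + b\<^sup>2 + 2)) * ?l)
      \<le> (\<integral>\<^sup>+\<beta>'. ennreal (L (step_fun s (eb_cell s) \<beta>')) \<partial>?N)"
    using mult_left_mono[OF mass, of "ennreal ?l"]
    by (subst ennreal_mult) (auto simp: mult.commute L_def likelihood_nonneg)
  then have "ennreal (block_weight c s / (\<Sum>j. block_weight c j))
        * ennreal (exp (- real s * (ln (real n) / 2 + b\<^sup>2 + 2)) * ?l)
      \<le> ennreal (block_weight c s / (\<Sum>j. block_weight c j))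
        * (\<integral>\<^sup>+\<beta>'. ennreal (L (step_fun s (eb_cell s) \<beta>')) \<partial>?N)"
    by (rule mult_left_mono) simp
  also have "\<dots> \<le> (\<integral>\<^sup>+f. ennreal (L f) \<partial>eb_prior c)"
  proof -
    have meas: "(\<lambda>f. ennreal (L f)) \<in> borel_measurable step_space"
      unfolding L_def by measurable
    let ?t = "\<lambda>K. ennreal (block_weight c K / (\<Sum>j. block_weight c j)) *
      (\<integral>\<^sup>+\<beta>. ennreal (L (step_fun K (eb_cell K) \<beta>)) \<partial>(\<Pi>\<^sub>M k\<in>{1..K}. std_normal_distribution))"
    have "sum ?t {s} \<le> suminf ?t" by (rule sum_le_suminf) auto
    then show ?thesis unfolding nn_integral_eb_prior[OF c meas] by simp
  qed
  finally show ?thesis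
    using block_weight_nonneg[of c s] suminf_block_weight_pos[OF c]
    by (subst ennreal_mult) (auto simp: L_def likelihood_nonneg)
qed

section \<open>Posterior mass for a fixed noise vector\<close>

lemma ennreal_inverse_antimono: "a \<le> b \<Longrightarrow> inverse b \<le> inverse (a :: ennreal)"
  by (simp add: less_eq_ennreal.rep_eq inverse_ennreal.rep_eq ereal_inverse_antimono)

lemma ennreal_divide_mono:
  fixes a b c d :: ennreal
  assumes "a \<le> b" "d \<le> c"
  shows "a / c \<le> b / d"
  unfolding divide_ennreal_def using assms by (intro mult_mono ennreal_inverse_antimono) auto

lemma emeasure_posterior:
  assumes c: "c > 0" and A: "A \<in> sets (eb_prior c)"
  shows "emeasure (posterior (eb_prior c) n Y) A = (\<Sum>K. ennreal (block_weight c K / (\<Sum>j. block_weight c j)) *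
     (\<integral>\<^sup>+\<beta>. ennreal (likelihood n (step_fun K (eb_cell K) \<beta>) Y)
         / (\<integral>\<^sup>+g. ennreal (likelihood n g Y) \<partial>eb_prior c) * indicator A (step_fun K (eb_cell K) \<beta>)
       \<partial>(\<Pi>\<^sub>M k\<in>{1..K}. std_normal_distribution)))"
proof -
  have [measurable]: "A \<in> sets step_space" using A by (simp add: sets_eb_prior)
  show ?thesis
    unfolding posterior_def using A
    by (subst emeasure_density) (auto simp: nn_integral_eb_prior[OF c])
qed

text \<open>A posterior probability is at most \<open>1\<close> and at most the ratio \<open>y\<close> of bounds for numerator and
  evidence; this interpolates between the two.\<close>

lemma min_one_le_powr:
  fixes y :: real
  assumes "0 \<le> y" "0 \<le> a" "a \<le> 1"
  shows "min 1 y \<le> y powr a"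
proof (cases "y \<le> 1")
  case True
  then have "y powr 1 \<le> y powr a" using assms by (intro powr_mono') auto
  then show ?thesis using assms True by simp
next
  case False
  then show ?thesis using assms by (auto intro: ge_one_powr_ge_zero)
qed

text \<open>For each number \<open>K\<close> of blocks the numerator carries \<open>exp (T K)\<close> and the evidence \<open>exp (- T K)\<close>, so
  that their ratio contains \<open>exp (2 * T K)\<close>, which has infinite expectation. Since each term is also
  at most \<open>1\<close>, it may be replaced by its power with exponent \<open>1 / 8\<close>; this leaves \<open>exp (T K / 4)\<close>, whose
  expectation is known.\<close>

lemma emeasure_posterior_le:
  fixes n s :: nat and e \<beta> :: "nat \<Rightarrow> real" and f0 :: "real \<Rightarrow> real"
  assumes c: "c > 0" and n: "n \<ge> 1" and s: "s \<ge> 1"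
    and f0: "\<And>x. 0 < x \<Longrightarrow> x \<le> 1 \<Longrightarrow> f0 x = \<beta> (block_index s x)"
    and b: "\<And>k. k \<in> {1..s} \<Longrightarrow> \<bar>\<beta> k\<bar> \<le> b"
    and A: "A \<in> sets (eb_prior c)" and far: "\<And>f. f \<in> A \<Longrightarrow> sq_dist n f f0 \<ge> R"
  defines "T \<equiv> \<lambda>K. projection_energy {1..n} (refinement_label n K s) e"
    and "E \<equiv> c * real s * ln (real s) + real s * (ln (real n) / 2 + b\<^sup>2 + 2) + 1 - R / 4"
  shows "emeasure (posterior (eb_prior c) n (observe n f0 e)) A
    \<le> (\<Sum>K. ennreal (block_weight c K powr (1 / 8) * exp (E / 8)) * ennreal (exp (T K / 4)))"
proof -
  let ?Y = "observe n f0 e" and ?W = "\<Sum>j. block_weight c j"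
  let ?L = "\<lambda>f. likelihood n f ?Y"
  let ?Z = "\<integral>\<^sup>+g. ennreal (?L g) \<partial>eb_prior c"
  let ?q = "exp (- real s * (ln (real n) / 2 + b\<^sup>2 + 2))"
  let ?t = "\<lambda>K. ennreal (block_weight c K / ?W) *
     (\<integral>\<^sup>+\<beta>. ennreal (?L (step_fun K (eb_cell K) \<beta>)) / ?Z * indicator A (step_fun K (eb_cell K) \<beta>)
       \<partial>(\<Pi>\<^sub>M k\<in>{1..K}. std_normal_distribution))"
  have W: "?W > 0" by (rule suminf_block_weight_pos[OF c])
  have ws: "block_weight c s = exp (- c * real s * ln (real s))"
    using s by (simp add: block_weight_def)
  have split: "emeasure (posterior (eb_prior c) n ?Y) A = suminf ?t"
    by (rule emeasure_posterior[OF c A])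
  interpret post: prob_space "posterior (eb_prior c) n ?Y" by (rule prob_space_posterior)
  have le_1: "?t K \<le> 1" for K
  proof -
    have "sum ?t {K} \<le> suminf ?t" by (rule sum_le_suminf) auto
    also have "\<dots> \<le> 1" unfolding split[symmetric] by (rule post.measure_le_1)
    finally show ?thesis by simp
  qed
  have le_ratio: "?t K \<le> ennreal (block_weight c K * exp (E + 2 * T K))" for K
  proof -
    interpret N: prob_space "\<Pi>\<^sub>M k\<in>{1..K}. std_normal_distribution"
      by (intro prob_space_PiM prob_space_normal_density) simp
    \<comment> \<open>\<open>z\<close> bounds the evidence from below; \<open>u\<close> bounds the posterior density on \<open>A\<close> from above.\<close>
    define z where "z = block_weight c s / ?W * (?q * (?L f0 * exp (- T K - 1)))"
    define u where "u = ?L f0 * exp (T K - R / 4) / z"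
    have z: "z > 0" unfolding z_def ws using W by (intro mult_pos_pos divide_pos_pos likelihood_pos) auto
    have Z: "ennreal z \<le> ?Z" unfolding z_def T_def by (rule evidence_ge[where ?f0.0 = f0 and \<beta>=\<beta> and b=b, OF c n s f0 b])
    have "ennreal (?L f) / ?Z * indicator A f \<le> ennreal u" if f: "f = step_fun K (eb_cell K) \<beta>'" for f \<beta>'
    proof (cases "f \<in> A")
      case True
      have "?L f \<le> ?L f0 * exp (T K - sq_dist n f f0 / 4)"
        unfolding T_def f by (rule likelihood_bounds_by_energy(1)[where ?f0.0 = f0 and \<beta> = \<beta>, OF s _ f0]) auto
      also have "\<dots> \<le> ?L f0 * exp (T K - R / 4)"
        using far[OF True] by (intro mult_left_mono likelihood_nonneg) auto
      finally have "ennreal (?L f) / ?Z \<le> ennreal (?L f0 * exp (T K - R / 4)) / ennreal z"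
        using Z by (intro ennreal_divide_mono ennreal_leI) auto
      also have "\<dots> = ennreal u"
        unfolding u_def using z by (intro divide_ennreal) (auto simp: likelihood_nonneg)
      finally show ?thesis using True by simp
    qed simp
    then have "?t K \<le> ennreal (block_weight c K / ?W) *
        (\<integral>\<^sup>+\<beta>. ennreal u \<partial>(\<Pi>\<^sub>M k\<in>{1..K}. std_normal_distribution))"
      by (intro mult_left_mono nn_integral_mono) auto
    also have "\<dots> = ennreal (block_weight c K / ?W * u)"
      using W block_weight_nonneg[of c K]
      unfolding nn_integral_const N.emeasure_space_1 mult_1_right
      by (intro ennreal_mult'[symmetric] divide_nonneg_pos)
    also have "block_weight c K / ?W * u
        = block_weight c K * (exp (T K - R / 4) / (exp (- c * real s * ln (real s)) * ?q * exp (- T K - 1)))"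
      unfolding u_def z_def ws using W likelihood_pos[of n f0 ?Y] by (simp add: field_simps)
    also have "exp (T K - R / 4) / (exp (- c * real s * ln (real s)) * ?q * exp (- T K - 1)) = exp (E + 2 * T K)"
      unfolding E_def by (simp add: algebra_simps flip: exp_add exp_diff)
    finally show ?thesis .
  qed
  have "?t K \<le> ennreal (block_weight c K powr (1 / 8) * exp (E / 8)) * ennreal (exp (T K / 4))" for K
  proof -
    let ?y = "block_weight c K * exp (E + 2 * T K)"
    have "?t K \<le> ennreal (min 1 ?y)"
      using le_1[of K] le_ratio[of K] by (simp add: min_def)
    also have "\<dots> \<le> ennreal (?y powr (1 / 8))"
      by (intro ennreal_leI min_one_le_powr) (auto simp: block_weight_nonneg)
    also have "?y powr (1 / 8) = block_weight c K powr (1 / 8) * exp (E / 8) * exp (T K / 4)"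
      by (simp add: powr_mult block_weight_nonneg exp_powr_real add_divide_distrib exp_add)
    finally show ?thesis by (simp add: ennreal_mult)
  qed
  then show ?thesis unfolding split by (intro suminf_le) auto
qed

section \<open>Expected posterior mass and contraction\<close>

text \<open>The prior weight decays faster than any geometric sequence, so all numbers of blocks can be summed
  at once, although the dimension of the competing models is unbounded.\<close>

lemma summable_block_weight_powr:
  assumes "c > 0" "a > 0" "r > 0"
  shows "summable (\<lambda>k. block_weight c k powr a * r ^ k)"
proof (rule summable_comparison_test_ev)
  show "summable (\<lambda>k. exp (- 1) ^ k :: real)" by (intro summable_geometric) simp
  have "filterlim (\<lambda>k. ln (real k)) at_top sequentially"
    by (rule filterlim_compose[OF ln_at_top filterlim_real_sequentially])
  then have "\<forall>\<^sub>F k in sequentially. (ln r + 1) / (c * a) \<le> ln (real k)"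
    by (simp add: filterlim_at_top)
  then show "\<forall>\<^sub>F k in sequentially. norm (block_weight c k powr a * r ^ k) \<le> exp (- 1) ^ k"
    using eventually_ge_at_top[of 1]
  proof eventually_elim
    case (elim k)
    then have "ln r + 1 \<le> c * a * ln (real k)" using assms by (simp add: field_simps)
    then have "real k * (ln r + 1) \<le> real k * (c * a * ln (real k))" by (intro mult_left_mono) auto
    moreover have "r ^ k = exp (real k * ln r)" using assms by (simp add: exp_of_nat_mult)
    moreover have "block_weight c k powr a = exp (- (real k * (c * a * ln (real k))))"
      using elim by (simp add: block_weight_def exp_powr_real algebra_simps)
    ultimately show ?case
      by (simp add: algebra_simps flip: exp_add exp_of_nat_mult)
  qed
qed

lemma emeasure_posterior_eq:
  "emeasure (posterior (eb_prior c) n Y) A = ennreal (measure (posterior (eb_prior c) n Y) A)"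
proof -
  interpret prob_space "posterior (eb_prior c) n Y" by (rule prob_space_posterior)
  show ?thesis by (rule emeasure_eq_measure)
qed

text \<open>The nonasymptotic form of the contraction statement. The common refinement contributes
  \<open>sqrt 2 ^ (K + s)\<close>; the part in \<open>K\<close> is absorbed by the prior weight, and the part in \<open>s\<close> is of smaller
  order than the complexity term \<open>s * ln n\<close> inside \<open>E\<close>.\<close>

lemma expected_posterior_mass_le:
  fixes n s :: nat and \<beta> :: "nat \<Rightarrow> real" and f0 :: "real \<Rightarrow> real"
  assumes c: "c > 0" and n: "n \<ge> 1" and s: "s \<ge> 1"
    and f0: "\<And>x. 0 < x \<Longrightarrow> x \<le> 1 \<Longrightarrow> f0 x = \<beta> (block_index s x)"
    and b: "\<And>k. k \<in> {1..s} \<Longrightarrow> \<bar>\<beta> k\<bar> \<le> b"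
    and A: "A \<in> sets (eb_prior c)" and far: "\<And>f. f \<in> A \<Longrightarrow> sq_dist n f f0 \<ge> R"
  defines "E \<equiv> c * real s * ln (real s) + real s * (ln (real n) / 2 + b\<^sup>2 + 2) + 1 - R / 4"
  shows "(\<integral>\<^sup>+Y. ennreal (measure (posterior (eb_prior c) n Y) A) \<partial>obs_law n f0)
    \<le> ennreal (exp (E / 8) * sqrt 2 ^ s * (\<Sum>K. block_weight c K powr (1 / 8) * sqrt 2 ^ K))"
proof -
  let ?N = "\<Pi>\<^sub>M i\<in>{1..n}. std_normal_distribution"
  let ?T = "\<lambda>K. projection_energy {1..n} (refinement_label n K s)"
  let ?a = "\<lambda>K. block_weight c K powr (1 / 8) * exp (E / 8)"
  let ?w = "\<lambda>K. block_weight c K powr (1 / 8) * sqrt 2 ^ K"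
  have [measurable]: "?T K \<in> borel_measurable ?N" for K
    by (subst measurable_cong_sets[OF sets_PiM_std_normal refl]) (rule measurable_projection_energy, simp)
  have "(\<lambda>Y. measure (posterior (eb_prior c) n Y) A) \<in> borel_measurable (\<Pi>\<^sub>M i\<in>{1..n}. borel)"
    using measurable_posterior[OF A, of n f0] by (simp add: obs_law_def)
  then have "(\<integral>\<^sup>+Y. ennreal (measure (posterior (eb_prior c) n Y) A) \<partial>obs_law n f0)
      = (\<integral>\<^sup>+e. emeasure (posterior (eb_prior c) n (observe n f0 e)) A \<partial>?N)"
    by (subst nn_integral_obs_law) (auto simp: emeasure_posterior_eq)
  also have "\<dots> \<le> (\<integral>\<^sup>+e. (\<Sum>K. ennreal (?a K) * ennreal (exp (?T K e / 4))) \<partial>?N)"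
    unfolding E_def
    by (intro nn_integral_mono
        emeasure_posterior_le[where ?f0.0 = f0 and \<beta> = \<beta> and b = b and R = R, OF c n s f0 b A far])
  also have "\<dots> = (\<Sum>K. ennreal (?a K) * (\<integral>\<^sup>+e. ennreal (exp (?T K e / 4)) \<partial>?N))"
    by (subst nn_integral_suminf) (auto simp: nn_integral_cmult)
  also have "\<dots> \<le> (\<Sum>K. ennreal (exp (E / 8) * sqrt 2 ^ s * ?w K))"
  proof (rule suminf_le)
    fix K
    have "sqrt 2 ^ card (refinement_label n K s ` {1..n}) \<le> sqrt 2 ^ (K + s)"
      by (intro power_increasing card_refinement_label s) simp
    then have "?a K * sqrt 2 ^ card (refinement_label n K s ` {1..n}) \<le> ?a K * sqrt 2 ^ (K + s)"
      by (intro mult_left_mono) auto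
    then show "ennreal (?a K) * (\<integral>\<^sup>+e. ennreal (exp (?T K e / 4)) \<partial>?N)
        \<le> ennreal (exp (E / 8) * sqrt 2 ^ s * ?w K)"
      by (simp add: nn_integral_exp_projection_energy power_add mult_ac ennreal_leI flip: ennreal_mult)
  qed auto
  also have "\<dots> = ennreal (\<Sum>K. exp (E / 8) * sqrt 2 ^ s * ?w K)"
    using c by (intro suminf_ennreal2 summable_mult summable_block_weight_powr) auto
  also have "(\<Sum>K. exp (E / 8) * sqrt 2 ^ s * ?w K) = exp (E / 8) * sqrt 2 ^ s * (\<Sum>K. ?w K)"
    using c by (intro suminf_mult summable_block_weight_powr) auto
  finally show ?thesis .
qed

lemma prob_gt_le_of_nn_integral_le:
  assumes u: "u \<in> borel_measurable P" and nonneg: "\<And>y. u y \<ge> (0::real)" and "\<delta> > 0" "B \<ge> 0"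
    and le: "(\<integral>\<^sup>+y. ennreal (u y) \<partial>P) \<le> ennreal B"
  shows "measure P {y \<in> space P. \<bar>u y\<bar> > \<delta>} \<le> B / \<delta>"
proof -
  have [measurable]: "u \<in> borel_measurable P" by (rule u)
  have "emeasure P {y \<in> space P. \<bar>u y\<bar> > \<delta>}
      \<le> emeasure P {y \<in> space P. 1 \<le> ennreal (1 / \<delta>) * ennreal (u y)}"
    using assms(3) nonneg
    by (intro emeasure_mono) (auto simp flip: ennreal_mult ennreal_1 intro!: ennreal_leI)
  also have "\<dots> \<le> ennreal (1 / \<delta>) * (\<integral>\<^sup>+y. ennreal (u y) * indicator (space P) y \<partial>P)"
    by (rule nn_integral_Markov_inequality) auto
  also have "(\<integral>\<^sup>+y. ennreal (u y) * indicator (space P) y \<partial>P) = (\<integral>\<^sup>+y. ennreal (u y) \<partial>P)"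
    by (intro nn_integral_cong) auto
  also have "ennreal (1 / \<delta>) * \<dots> \<le> ennreal (1 / \<delta>) * ennreal B"
    by (intro mult_left_mono le) auto
  also have "\<dots> = ennreal (B / \<delta>)" using assms(3,4) by (simp flip: ennreal_mult)
  finally show ?thesis
    unfolding measure_def using assms(3,4) by (intro enn2real_leI) auto
qed

text \<open>Here \<open>L\<close> is \<open>ln n\<close>, \<open>l\<close> is \<open>ln s\<close>, \<open>b2\<close> bounds the squared heights, \<open>r\<close> is \<open>ln (n / s)\<close> and \<open>m\<close> is the
  squared radius factor. All costs are of order \<open>s * L\<close>, and so is the gain \<open>m * s * r\<close>; a sufficiently
  large constant \<open>m\<close> makes the gain prevail.\<close>

lemma contraction_exponent_le:
  fixes s L l b2 r m c C :: real
  assumes "c > 0" "C \<ge> 0" "s \<ge> 1" "L \<ge> 1" and l: "l \<le> L" and b2: "b2 \<le> C * L" and r: "L / 4 \<le> r"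
    and m: "m \<ge> 16 * (c + C + 4) + 256"
  shows "(c * s * l + s * (L / 2 + b2 + 2) + 1 - m * (s * r) / 4) / 8 + s \<le> - L"
proof -
  have sL: "s \<le> s * L" "1 \<le> s * L" "L \<le> s * L"
    using assms(3,4) mult_left_mono[of 1 L s] mult_right_mono[of 1 s L] mult_mono[of 1 s 1 L] by auto
  have "c * s * l \<le> c * (s * L)" using mult_left_mono[OF l, of "c * s"] assms by (simp add: mult_ac)
  moreover have "s * b2 \<le> C * (s * L)" using mult_left_mono[OF b2, of s] assms by (simp add: mult_ac)
  moreover have "4 * (c * (s * L)) + 4 * (C * (s * L)) + 80 * (s * L) \<le> m * (s * r)"
  proof -
    have "4 * (c * (s * L)) + 4 * (C * (s * L)) + 80 * (s * L) = (16 * (c + C + 4) + 256) * (s * L / 4)"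
      by (simp add: algebra_simps)
    also have "\<dots> \<le> m * (s * r)"
      using mult_left_mono[OF r, of s] assms by (intro mult_mono m) auto
    finally show ?thesis .
  qed
  moreover have "(x + (p / 2 + y + s * 2) + 1 - q / 4) / 8 + s \<le> - L"
    if "x \<le> u" "y \<le> v" "4 * u + 4 * v + 80 * p \<le> q" "s \<le> p" "1 \<le> p" "L \<le> p" for x y u v p q :: real
    using that by (simp add: field_simps)
  ultimately show ?thesis
    unfolding distrib_left[of s] times_divide_eq_right using sL by blast
qed

lemma sq_dist_ge_of_emp_norm_ge:
  assumes "n \<ge> 1" "m \<ge> 0" "v \<ge> 0"
    and "emp_norm n (\<lambda>x. f x - g x) \<ge> m * real n powr (- 1 / 2) * sqrt v"
  shows "sq_dist n f g \<ge> m\<^sup>2 * v"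
proof -
  have "(m * real n powr (- 1 / 2) * sqrt v)\<^sup>2 \<le> (emp_norm n (\<lambda>x. f x - g x))\<^sup>2"
    using assms by (intro power_mono) auto
  also have "(m * real n powr (- 1 / 2) * sqrt v)\<^sup>2 = m\<^sup>2 * v / real n"
    using assms by (simp add: power_mult_distrib powr_minus powr_half_sqrt power_divide field_simps)
  also have "(emp_norm n (\<lambda>x. f x - g x))\<^sup>2 = sq_dist n f g / real n"
    by (simp add: emp_norm_def sum_nonneg)
  finally show ?thesis using assms(1) by (simp add: divide_le_cancel)
qed

theorem theorem3p1:
  fixes c\<^sub>K :: real
    and f0 :: "nat \<Rightarrow> real \<Rightarrow> real"
    and K0 :: "nat \<Rightarrow> nat"
    and \<Omega>0 :: "nat \<Rightarrow> nat \<Rightarrow> real set"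
    and \<beta>0 :: "nat \<Rightarrow> nat \<Rightarrow> real"
    and Kf0 :: "nat \<Rightarrow> nat"
    and M :: "nat \<Rightarrow> real"
  assumes "c\<^sub>K > 0"
    and "\<And>n. n \<ge> 1 \<Longrightarrow> minimally_represents (f0 n) (K0 n) (\<Omega>0 n) (\<beta>0 n)"
    and "\<And>n. n \<ge> 1 \<Longrightarrow> complexity (K0 n) (\<Omega>0 n) eb_partitions = enat (Kf0 n)"
    and "\<exists>C. \<forall>\<^sub>F n in sequentially. (MAX k\<in>{1..K0 n}. \<bar>\<beta>0 n k\<bar>)\<^sup>2 \<le> C * ln (real n)"
    and "\<exists>C. \<forall>\<^sub>F n in sequentially. real (Kf0 n) \<le> C * sqrt (real n)"
    and "filterlim M at_top sequentially"
  shows "tendsto_0_in_prob (\<lambda>n. obs_law n (f0 n))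
    (\<lambda>n Y. measure (posterior (eb_prior c\<^sub>K) n Y)
       {f \<in> eb_step_functions.
          emp_norm n (\<lambda>x. f x - f0 n x) \<ge>
            M n * real n powr (- 1 / 2) * sqrt (real (Kf0 n) * ln (real n / real (Kf0 n)))})"
  unfolding tendsto_0_in_prob_def
proof (intro allI impI)
  fix \<delta> :: real assume \<delta>: "\<delta> > 0"
  let ?A = "\<lambda>n. {f \<in> eb_step_functions. emp_norm n (\<lambda>x. f x - f0 n x) \<ge>
            M n * real n powr (- 1 / 2) * sqrt (real (Kf0 n) * ln (real n / real (Kf0 n)))}"
  let ?post = "\<lambda>n Y. measure (posterior (eb_prior c\<^sub>K) n Y) (?A n)"
  let ?P = "\<lambda>n. measure (obs_law n (f0 n)) {Y \<in> space (obs_law n (f0 n)). \<bar>?post n Y\<bar> > \<delta>}"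
  define S where "S = (\<Sum>K. block_weight c\<^sub>K K powr (1 / 8) * sqrt 2 ^ K)"
  have S: "S \<ge> 0" unfolding S_def
    using assms(1) by (intro suminf_nonneg summable_block_weight_powr) auto
  obtain C1 where C1: "\<forall>\<^sub>F n in sequentially. (MAX k\<in>{1..K0 n}. \<bar>\<beta>0 n k\<bar>)\<^sup>2 \<le> C1 * ln (real n)"
    using assms(4) by blast
  obtain C2 where C2: "\<forall>\<^sub>F n in sequentially. real (Kf0 n) \<le> C2 * sqrt (real n)"
    using assms(5) by blast
  define B where "B = max C1 0"
  define D where "D = max C2 1"
  have ln_top: "filterlim (\<lambda>n. ln (real n)) at_top sequentially"
    by (rule filterlim_compose[OF ln_at_top filterlim_real_sequentially])
  have "\<forall>\<^sub>F n in sequentially. max 1 (4 * ln D) \<le> ln (real n)"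
    and "\<forall>\<^sub>F n in sequentially. 16 * (c\<^sub>K + B + 4) + 256 \<le> M n"
    using ln_top assms(6) unfolding filterlim_at_top by blast+
  then have upper: "\<forall>\<^sub>F n in sequentially. ?P n \<le> S / \<delta> * (1 / real n)"
    using C1 C2 eventually_ge_at_top[of 1]
  proof eventually_elim
    case (elim n)
    let ?s = "Kf0 n" and ?L = "ln (real n)" and ?b = "MAX k\<in>{1..K0 n}. \<bar>\<beta>0 n k\<bar>"
    let ?R = "(M n)\<^sup>2 * (real ?s * ln (real n / real ?s))"
    let ?E = "c\<^sub>K * real ?s * ln (real ?s) + real ?s * (?L / 2 + ?b\<^sup>2 + 2) + 1 - ?R / 4"
    have "represents (f0 n) (K0 n) (\<Omega>0 n) (\<beta>0 n)"
      using assms(2) elim by (simp add: minimally_represents_def)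
    from blockwise_constant_of_complexity[OF this assms(3)[OF elim(5)]]
    obtain \<beta> where s: "?s \<ge> 1"
      and "\<forall>x. 0 < x \<longrightarrow> x \<le> 1 \<longrightarrow> f0 n x = \<beta> (block_index ?s x)"
      and "\<forall>k\<in>{1..?s}. \<bar>\<beta> k\<bar> \<le> ?b" by blast
    then have f0: "\<And>x. 0 < x \<Longrightarrow> x \<le> 1 \<Longrightarrow> f0 n x = \<beta> (block_index ?s x)"
      and b: "\<And>k. k \<in> {1..?s} \<Longrightarrow> \<bar>\<beta> k\<bar> \<le> ?b"
      by blast+
    have L: "?L \<ge> 1" "4 * ln D \<le> ?L" using elim(1) by auto
    have b2: "?b\<^sup>2 \<le> B * ?L"
      using elim(3) mult_right_mono[of C1 B ?L] L unfolding B_def by linarith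
    \<comment> \<open>As \<open>s\<close> is at most of order \<open>sqrt n\<close>, \<open>ln (n / s)\<close> is comparable to \<open>ln n\<close>; this matters because
      the costs are of order \<open>s * ln n\<close>.\<close>
    have "real ?s \<le> D * sqrt (real n)"
      using elim(4) mult_right_mono[of C2 D "sqrt (real n)"] by (simp add: D_def)
    then have "ln (real ?s) \<le> ln (D * sqrt (real n))"
      using s by (subst ln_le_cancel_iff) (auto simp: D_def elim)
    also have "\<dots> = ln D + ?L / 2"
      using elim(5) by (simp add: D_def ln_mult ln_sqrt)
    finally have ln_s: "ln (real ?s) \<le> 3 / 4 * ?L" using L by simp
    have r: "?L / 4 \<le> ln (real n / real ?s)" using ln_s s elim(5) by (simp add: ln_div)
    have M1: "M n \<ge> 1" using elim(2) assms(1) by (simp add: B_def)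
    have m: "(M n)\<^sup>2 \<ge> 16 * (c\<^sub>K + B + 4) + 256"
      using elim(2) M1 mult_left_mono[of 1 "M n" "M n"] unfolding power2_eq_square by linarith
    have "?E / 8 + real ?s \<le> - ?L"
      using assms(1) s L(1) ln_s b2 r m by (intro contraction_exponent_le) (auto simp: B_def)
    then have "exp (?E / 8 + real ?s) \<le> exp (- ?L)" by (simp only: exp_le_cancel_iff)
    also have "exp (- ?L) = 1 / real n"
      using elim(5) by (simp add: exp_minus inverse_eq_divide)
    finally have exponent: "exp (?E / 8) * exp (real ?s) \<le> 1 / real n" by (simp only: exp_add)
    have "sqrt 2 \<le> exp 1"
      using exp_ge_add_one_self[of 1] sqrt2_less_2 by linarith
    then have "sqrt 2 ^ ?s \<le> exp (real ?s)"
      using power_mono[of "sqrt 2" "exp 1" ?s] by (simp flip: exp_of_nat_mult)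
    then have "exp (?E / 8) * sqrt 2 ^ ?s * S \<le> exp (?E / 8) * exp (real ?s) * S"
      by (intro mult_right_mono mult_left_mono S) auto
    also have "\<dots> \<le> 1 / real n * S"
      using exponent by (intro mult_right_mono S)
    finally have bound: "exp (?E / 8) * sqrt 2 ^ ?s * S \<le> 1 / real n * S" .
    have A: "?A n \<in> sets (eb_prior c\<^sub>K)" by (rule sets_emp_norm_event)
    have far: "sq_dist n f (f0 n) \<ge> ?R" if "f \<in> ?A n" for f
      using that elim(5) M1 L(1) r by (intro sq_dist_ge_of_emp_norm_ge) auto
    have "(\<integral>\<^sup>+Y. ennreal (?post n Y) \<partial>obs_law n (f0 n)) \<le> ennreal (exp (?E / 8) * sqrt 2 ^ ?s * S)"
      unfolding S_def
      by (rule expected_posterior_mass_le[where ?f0.0 = "f0 n" and \<beta> = \<beta> and b = ?b and R = ?R,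
            OF assms(1) elim(5) s f0 b A far])
    also have "\<dots> \<le> ennreal (1 / real n * S)" by (intro ennreal_leI bound)
    finally have "?P n \<le> 1 / real n * S / \<delta>"
      by (intro prob_gt_le_of_nn_integral_le measurable_posterior A measure_nonneg \<delta>) (use S in auto)
    then show ?case by (simp add: mult.commute)
  qed
  have limit: "(\<lambda>n. S / \<delta> * (1 / real n)) \<longlonglongrightarrow> 0"
    by (rule tendsto_mult_right_zero) (rule lim_1_over_n)
  have "\<forall>\<^sub>F n in sequentially. 0 \<le> ?P n" by (simp add: measure_nonneg)
  from tendsto_sandwich[OF this upper tendsto_const limit] show "?P \<longlonglongrightarrow> 0" .
qed

end
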